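(* Let $\mathcal M=\{A,B,C,D\}$ be a minimal continuous-time system with $A\in\mathbb C^{n\times n}$, $B\in\mathbb C^{n\times m}$, $C\in\mathbb C^{m\times n}$, $D\in\mathbb C^{m\times m}$ and $\operatorname{rank}B=\operatorname{rank}C=m$. Let $X\in\mathbb C^{n\times n}$ be Hermitian with $X\succ 0$ and $W_c(X,\mathcal M)\succ 0$. The $X$-passivity radius, defined as $$\rho^c_{\mathcal M}(X):=\inf_{\Delta_{\mathcal M}}\{\|\Delta_{\mathcal M}\| : \det W_c(X,\mathcal M+\Delta_{\mathcal M})=0\},$$ satisfies $$\lambda_{\min}\bigl(Y_c\,W_c(X,\mathcal M)\,Y_c\bigr)\le\rho^c_{\mathcal M}(X),\qquad\text{where}\quad Y_c:=\begin{bmatrix}I_n+X^2&0\\0&I_m\end{bmatrix}^{-1/2}\preceq I_{n+m}.$$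
   Context: $V^{\mathsf H}$ denotes the conjugate transpose; $\succ 0$ means Hermitian positive definite, and $\lambda_{\min}$ is the smallest eigenvalue of a Hermitian matrix. The system is minimal if $(A,B)$ and $(A^{\mathsf H},C^{\mathsf H})$ are controllable. For a quadruple $\mathcal M=\{A,B,C,D\}$ and Hermitian $X$, $$W_c(X,\mathcal M):=\begin{bmatrix}-A^{\mathsf H}X-XA & C^{\mathsf H}-XB\\ C-B^{\mathsf H}X & D+D^{\mathsf H}\end{bmatrix}.$$ A perturbation is a quadruple $\Delta_{\mathcal M}=\{\Delta_A,\Delta_B,\Delta_C,\Delta_D\}$ of complex matrices of the same sizes as $A,B,C,D$; $\mathcal M+\Delta_{\mathcal M}:=\{A+\Delta_A,B+\Delta_B,C+\Delta_C,D+\Delta_D\}$; its size is measured by the spectral norm $$\|\Delta_{\mathcal M}\|:=\left\|\begin{bmatrix}0&\Delta_A&\Delta_B\\ \Delta_A^{\mathsf H}&0&\Delta_C^{\mathsf H}\\ \Delta_B^{\mathsf H}&\Delta_C&\Delta_D+\Delta_D^{\mathsf H}\end{bmatrix}\right\|_2 .$$ *)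

theory Defs
  imports "HOL-Analysis.Analysis"
begin

text \<open>
  A \<open>p \<times> q\<close> matrix has type \<open>complex^'q^'p\<close>; block matrices are indexed by sum types.
  Note that on \<open>_^_^_\<close> the operations \<open>*\<close> and \<open>^\<close> are entrywise, so matrix products and
  squares are written with \<open>**\<close>.
\<close>

definition ctranspose :: "complex^'q^'p \<Rightarrow> complex^'p^'q"  ("_\<^sup>H" [1000] 999)
  where "V\<^sup>H = (\<chi> i j. cnj (V $ j $ i))"

definition hcat :: "'a^'q^'p \<Rightarrow> 'a^'r^'p \<Rightarrow> 'a^('q + 'r)^'p"
  where "hcat M N = (\<chi> i j. case j of Inl k \<Rightarrow> M $ i $ k | Inr k \<Rightarrow> N $ i $ k)"

definition vcat :: "'a^'q^'p \<Rightarrow> 'a^'q^'r \<Rightarrow> 'a^'q^('p + 'r)"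
  where "vcat M N = (\<chi> i. case i of Inl k \<Rightarrow> M $ k | Inr k \<Rightarrow> N $ k)"

definition hermitian :: "complex^'n^'n \<Rightarrow> bool"
  where "hermitian H \<longleftrightarrow> H\<^sup>H = H"

text \<open>The form \<open>v\<^sup>H H v\<close>. It is real for Hermitian \<open>H\<close>, so below only its real part is compared with 0.\<close>

definition qform :: "complex^'n^'n \<Rightarrow> complex^'n \<Rightarrow> complex"
  where "qform H v = (\<Sum>i\<in>UNIV. cnj (v $ i) * (H *v v) $ i)"

definition pos_def :: "complex^'n^'n \<Rightarrow> bool"
  where "pos_def H \<longleftrightarrow> hermitian H \<and> (\<forall>v. v \<noteq> 0 \<longrightarrow> Re (qform H v) > 0)"

definition pos_semidef :: "complex^'n^'n \<Rightarrow> bool"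
  where "pos_semidef H \<longleftrightarrow> hermitian H \<and> (\<forall>v. Re (qform H v) \<ge> 0)"

definition loewner_le :: "complex^'n^'n \<Rightarrow> complex^'n^'n \<Rightarrow> bool"  (infix "\<preceq>" 50)
  where "P \<preceq> Q \<longleftrightarrow> pos_semidef (Q - P)"

definition eigenvalue :: "complex^'n^'n \<Rightarrow> complex \<Rightarrow> bool"
  where "eigenvalue H c \<longleftrightarrow> (\<exists>v. v \<noteq> 0 \<and> H *v v = c *s v)"

text \<open>Only used for Hermitian matrices, whose eigenvalues are all real.\<close>

definition lambda_min :: "complex^'n^'n \<Rightarrow> real"
  where "lambda_min H = (LEAST r. eigenvalue H (complex_of_real r))"

text \<open>The norm of \<open>complex^'n\<close> is the Euclidean one, so this is the largest singular value.\<close>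

definition spectral_norm :: "complex^'q^'p \<Rightarrow> real"
  where "spectral_norm M = onorm (\<lambda>v. M *v v)"

text \<open>
  The principal square root of a positive semidefinite matrix, i.e. its unique positive
  semidefinite square root.
\<close>

definition matrix_sqrt :: "complex^'n^'n \<Rightarrow> complex^'n^'n"
  where "matrix_sqrt P = (THE S. pos_semidef S \<and> S ** S = P)"

text \<open>
  A system \<open>{A, B, C, D}\<close> with \<open>A\<close> of size \<open>n \<times> n\<close>, \<open>B\<close> of size \<open>n \<times> m\<close>, \<open>C\<close> of size \<open>m \<times> n\<close>
  and \<open>D\<close> of size \<open>m \<times> m\<close>. Perturbations have the same type and \<open>\<M> + \<Delta>\<close> is the componentwise
  addition of tuples.
\<close>

type_synonym ('n, 'm) system =
  "(complex^'n^'n) \<times> (complex^'m^'n) \<times> (complex^'n^'m) \<times> (complex^'m^'m)"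

text \<open>Controllability in the form \<open>rank [\<lambda>I - A, B] = n\<close> for all complex \<open>\<lambda>\<close> (Popov--Belevitch--Hautus).\<close>

definition controllable :: "complex^'n^'n \<Rightarrow> complex^'m^'n \<Rightarrow> bool"
  where "controllable A B \<longleftrightarrow> (\<forall>l::complex. rank (hcat (mat l - A) B) = CARD('n))"

fun minimal :: "('n::finite, 'm::finite) system \<Rightarrow> bool"
  where "minimal (A, B, C, D) \<longleftrightarrow> controllable A B \<and> controllable (A\<^sup>H) (C\<^sup>H)"

fun W_c :: "complex^'n^'n \<Rightarrow> ('n::finite, 'm::finite) system \<Rightarrow> complex^('n + 'm)^('n + 'm)"
  where "W_c X (A, B, C, D) =
    vcat (hcat (- (A\<^sup>H ** X) - X ** A) (C\<^sup>H - X ** B))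
         (hcat (C - B\<^sup>H ** X)          (D + D\<^sup>H))"

fun pert_norm :: "('n::finite, 'm::finite) system \<Rightarrow> real"
  where "pert_norm (\<Delta>A, \<Delta>B, \<Delta>C, \<Delta>D) = spectral_norm
    (vcat (hcat (0 :: complex^'n^'n) (hcat \<Delta>A \<Delta>B))
    (vcat (hcat (\<Delta>A\<^sup>H)             (hcat 0 (\<Delta>C\<^sup>H)))
          (hcat (\<Delta>B\<^sup>H)             (hcat \<Delta>C (\<Delta>D + \<Delta>D\<^sup>H)))))"

text \<open>
  The infimum is over a set that is bounded below by 0 and nonempty: for \<open>\<Delta> = - \<M>\<close> the matrix
  \<open>W_c X (\<M> + \<Delta>)\<close> is zero. So the infimum in the reals is the intended one.
\<close>

definition X_passivity_radius :: "complex^'n^'n \<Rightarrow> ('n::finite, 'm::finite) system \<Rightarrow> real"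
  where "X_passivity_radius X \<M> = Inf {pert_norm \<Delta> | \<Delta>. det (W_c X (\<M> + \<Delta>)) = 0}"

definition Y_c :: "complex^'n^'n \<Rightarrow> complex^('n::finite + 'm::finite)^('n + 'm)"
  where "Y_c X = matrix_inv (matrix_sqrt
    (vcat (hcat (mat 1 + X ** X) 0)
          (hcat 0                (mat 1))))"

end

theory Submission imports Defs
begin

text \<open>
  With \<open>Z = [-X 0; I 0; 0 I]\<close> and \<open>N\<close> the Hermitian block matrix whose norm measures \<open>\<Delta>\<close>, one has
  \<open>W_c X \<Delta> = Z\<^sup>H N Z\<close> and \<open>Z\<^sup>H Z = diag(I + X\<^sup>2, I)\<close>, so \<open>S = Y\<inverse>\<close> satisfies \<open>\<parallel>S v\<parallel> = \<parallel>Z v\<parallel>\<close>. If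
  \<open>W_c X (\<M> + \<Delta>) v = 0\<close> for some nonzero \<open>v\<close>, then
  \<open>\<lambda>\<^sub>m\<^sub>i\<^sub>n (Y W Y) \<parallel>S v\<parallel>\<^sup>2 \<le> v\<^sup>H W v = - (Z v)\<^sup>H N (Z v) \<le> \<parallel>N\<parallel> \<parallel>Z v\<parallel>\<^sup>2\<close>. The bound \<open>Y \<preceq> I\<close> holds
  because \<open>\<parallel>Z v\<parallel> \<ge> \<parallel>v\<parallel>\<close>.
\<close>

section \<open>Block matrices and the adjoint\<close>

lemma sum_UNIV_Plus:
  "(\<Sum>x\<in>(UNIV :: ('a::finite + 'b::finite) set). f x) = (\<Sum>x\<in>UNIV. f (Inl x)) + (\<Sum>x\<in>UNIV. f (Inr x))"
  by (simp add: UNIV_Plus_UNIV[symmetric] sum.Plus del: UNIV_Plus_UNIV)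

lemma vcat_mul: "vcat M N ** Q = vcat (M ** Q) (N ** Q)"
  by (simp add: vec_eq_iff vcat_def matrix_matrix_mult_def split: sum.split)

lemma mul_hcat: "Q ** hcat M N = hcat (Q ** M) (Q ** N)"
  by (simp add: vec_eq_iff hcat_def matrix_matrix_mult_def split: sum.split)

lemma hcat_mul_vcat: "hcat M N ** vcat P Q = M ** P + N ** Q"
  by (simp add: vec_eq_iff hcat_def vcat_def matrix_matrix_mult_def sum_UNIV_Plus)

lemma hcat_add: "hcat M N + hcat P Q = hcat (M + P) (N + Q)"
  by (simp add: vec_eq_iff hcat_def split: sum.split)

lemma vcat_add: "vcat M N + vcat P Q = vcat (M + P) (N + Q)"
  by (simp add: vec_eq_iff vcat_def split: sum.split)

lemma hcat_diff: "hcat M N - hcat P Q = hcat (M - P) (N - Q)"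
  by (simp add: vec_eq_iff hcat_def split: sum.split)

lemma vcat_diff: "vcat M N - vcat P Q = vcat (M - P) (N - Q)"
  by (simp add: vec_eq_iff vcat_def split: sum.split)

lemma hcat_vcat: "hcat (vcat M N) (vcat P Q) = vcat (hcat M P) (hcat N Q)"
  by (simp add: vec_eq_iff hcat_def vcat_def split: sum.split)

lemma hcat_0: "hcat 0 0 = 0"
  by (simp add: vec_eq_iff hcat_def split: sum.split)

lemma vcat_0: "vcat 0 0 = 0"
  by (simp add: vec_eq_iff vcat_def split: sum.split)

lemma matrix_mul_minus: "(- M) ** N = - (M ** (N :: complex^'q^'p))" "M ** (- N) = - (M ** N)"
  by (simp_all add: vec_eq_iff matrix_matrix_mult_def sum_negf)

lemma matrix_diff_ldistrib: "M ** (P - Q) = M ** P - M ** (Q :: complex^'q^'p)"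
  by (simp add: vec_eq_iff matrix_matrix_mult_def sum_subtractf algebra_simps)

lemma matrix_add_rdistrib: "(P + Q) ** M = P ** M + (Q :: complex^'q^'p) ** M"
  by (simp add: vec_eq_iff matrix_matrix_mult_def sum.distrib algebra_simps)

lemma matrix_diff_rdistrib: "(P - Q) ** M = P ** M - (Q :: complex^'q^'p) ** M"
  by (simp add: vec_eq_iff matrix_matrix_mult_def sum_subtractf algebra_simps)

section \<open>Algebra of the conjugate transpose\<close>

lemma ctranspose_hcat: "(hcat M N)\<^sup>H = vcat (M\<^sup>H) (N\<^sup>H)"
  by (simp add: vec_eq_iff hcat_def vcat_def ctranspose_def split: sum.split)

lemma ctranspose_vcat: "(vcat M N)\<^sup>H = hcat (M\<^sup>H) (N\<^sup>H)"
  by (simp add: vec_eq_iff hcat_def vcat_def ctranspose_def split: sum.split)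

lemma ctranspose_mul: "(M ** N)\<^sup>H = N\<^sup>H ** M\<^sup>H"
  by (simp add: vec_eq_iff ctranspose_def matrix_matrix_mult_def mult.commute)

lemma ctranspose_add: "(M + N)\<^sup>H = M\<^sup>H + N\<^sup>H"
  by (simp add: vec_eq_iff ctranspose_def)

lemma ctranspose_diff: "(M - N)\<^sup>H = M\<^sup>H - N\<^sup>H"
  by (simp add: vec_eq_iff ctranspose_def)

lemma ctranspose_minus: "(- M)\<^sup>H = - M\<^sup>H"
  by (simp add: vec_eq_iff ctranspose_def)

lemma ctranspose_0: "0\<^sup>H = 0"
  by (simp add: vec_eq_iff ctranspose_def)

lemma ctranspose_mat_1: "(mat 1)\<^sup>H = mat 1"
  by (simp add: vec_eq_iff ctranspose_def mat_def)

lemma ctranspose_scaleR: "(r *\<^sub>R M)\<^sup>H = r *\<^sub>R M\<^sup>H"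
  by (simp add: vec_eq_iff ctranspose_def)

lemma ctranspose_ctranspose: "(M\<^sup>H)\<^sup>H = M"
  by (simp add: vec_eq_iff ctranspose_def)

section \<open>Continuity, norm bounds and the real inner product\<close>

lemma continuous_on_ctranspose: "continuous_on S (\<lambda>M. M\<^sup>H)"
  unfolding ctranspose_def by (intro continuous_intros)

lemma continuous_on_matrix_mul:
  fixes f :: "'a::topological_space \<Rightarrow> complex^'q^'p"
  assumes "continuous_on S f" "continuous_on S g"
  shows "continuous_on S (\<lambda>x. f x ** g x)"
  unfolding matrix_matrix_mult_def using assms by (intro continuous_intros)

lemma continuous_on_matrix_vector_mul:
  fixes f :: "'a::topological_space \<Rightarrow> complex^'q^'p"
  assumes "continuous_on S f" "continuous_on S g"
  shows "continuous_on S (\<lambda>x. f x *v g x)"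
  unfolding matrix_vector_mult_def using assms by (intro continuous_intros)

lemma matrix_vector_mul_scaleR:
  fixes M :: "complex^'q^'p"
  shows "M *v (r *\<^sub>R v) = r *\<^sub>R (M *v v)" and "(r *\<^sub>R M) *v v = r *\<^sub>R (M *v v)"
  by (simp_all add: vec_eq_iff matrix_vector_mult_def scaleR_sum_right)

lemma norm_matrix_vector_mul_le: "norm (M *v v) \<le> spectral_norm M * norm v"
  unfolding spectral_norm_def by (rule onorm[OF matrix_vector_mul_bounded_linear])

lemma inner_complex_cnj: "x \<bullet> y = Re (cnj x * y)"
  by (simp add: inner_complex_def)

lemma Re_qform: "Re (qform H v) = v \<bullet> (H *v v)"
  by (simp add: qform_def inner_vec_def inner_complex_def)

lemma inner_ctranspose: "(M\<^sup>H *v u) \<bullet> v = u \<bullet> (M *v v)"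
proof -
  have "(\<Sum>i\<in>UNIV. cnj ((M\<^sup>H *v u) $ i) * v $ i) = (\<Sum>i\<in>UNIV. cnj (u $ i) * (M *v v) $ i)"
    unfolding matrix_vector_mult_def ctranspose_def
    by (simp add: sum_distrib_left sum_distrib_right, subst sum.swap, simp add: ac_simps)
  then have "Re (\<Sum>i\<in>UNIV. cnj ((M\<^sup>H *v u) $ i) * v $ i) = Re (\<Sum>i\<in>UNIV. cnj (u $ i) * (M *v v) $ i)"
    by simp
  then show ?thesis
    by (simp add: inner_vec_def inner_complex_cnj)
qed

lemma hermitian_inner: "hermitian H \<Longrightarrow> (H *v u) \<bullet> v = u \<bullet> (H *v v)"
  using inner_ctranspose[of H u v] by (simp add: hermitian_def)

section \<open>The smallest eigenvalue of a Hermitian matrix\<close>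

text \<open>A zero of a nonnegative form is a minimum. Moving from \<open>v\<close> to
  \<open>v - t w\<close> with \<open>w = H v\<close> changes the form by
  \<open>- 2 t |w|^2 + t^2 b\<close>, which is negative for small positive \<open>t\<close> unless
  \<open>w = 0\<close>.\<close>

lemma psd_kernel:
  fixes H :: "complex^'n^'n"
  assumes H: "hermitian H" and ge: "\<And>v. 0 \<le> v \<bullet> (H *v v)" and v: "v \<bullet> (H *v v) = 0"
  shows "H *v v = 0"
proof -
  define w where "w = H *v v"
  define b where "b = w \<bullet> (H *v w)"
  have 1: "0 \<le> - 2 * t * (w \<bullet> w) + t\<^sup>2 * b" for t
  proof -
    have "0 \<le> (v - t *\<^sub>R w) \<bullet> (H *v (v - t *\<^sub>R w))"
      by (rule ge)
    also have "\<dots> = v \<bullet> (H *v v) - t * (v \<bullet> (H *v w)) - t * (w \<bullet> (H *v v)) + t * (t * b)"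
      by (simp add: matrix_vector_mult_diff_distrib matrix_vector_mul_scaleR inner_diff b_def algebra_simps)
    also have "v \<bullet> (H *v w) = w \<bullet> w"
      using hermitian_inner[OF H, of v w] by (simp add: w_def)
    finally show ?thesis
      by (simp add: v[folded w_def] w_def[symmetric] power2_eq_square algebra_simps)
  qed
  have "b \<ge> 0" unfolding b_def by (rule ge)
  have "w \<bullet> w \<le> 0"
  proof (rule ccontr)
    assume "\<not> w \<bullet> w \<le> 0"
    then have pos: "w \<bullet> w > 0" by linarith
    \<comment> \<open>The \<open>+ 1\<close> keeps the denominator positive when
      \<open>b = 0\<close>; this \<open>t\<close> is small enough for the linear term to
      dominate.\<close>
    define t where "t = (w \<bullet> w) / (b + 1)"
    have t: "t > 0" "t * b < w \<bullet> w * 2"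
      using pos \<open>b \<ge> 0\<close> by (auto simp: t_def field_simps intro!: add_nonneg_pos)
    have "t * (- 2 * (w \<bullet> w) + t * b) \<ge> 0"
      using 1[of t] by (simp add: power2_eq_square algebra_simps)
    with t show False by (simp add: zero_le_mult_iff)
  qed
  then have "w = 0" using inner_gt_zero_iff[of w] by linarith
  then show ?thesis by (simp add: w_def)
qed

lemma mat_complex_vector_mul: "mat (complex_of_real r) *v v = r *\<^sub>R v"
  unfolding vec_eq_iff vector_scaleR_component
  by (simp add: matrix_vector_mult_def mat_def if_distrib[of "\<lambda>x. x * _"] scaleR_conv_of_real cong: if_cong)

lemma of_real_smult: "complex_of_real r *s v = r *\<^sub>R v"
  unfolding vec_eq_iff vector_scaleR_component by (simp add: scaleR_conv_of_real)

text \<open>By compactness the form attains a minimum \<open>r\<close> on the unit sphere. Then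
  \<open>H - r I\<close> has a nonnegative form that vanishes at the minimizer, and
  \<open>psd_kernel\<close> makes the minimizer an eigenvector.\<close>

lemma hermitian_min_eigenvalue:
  fixes H :: "complex^'n^'n"
  assumes H: "hermitian H"
  obtains r v where "v \<noteq> 0" "H *v v = r *\<^sub>R v" "\<And>u. r * (norm u)\<^sup>2 \<le> u \<bullet> (H *v u)"
proof -
  let ?S = "sphere (0 :: complex^'n) 1"
  have "?S \<noteq> {}" by simp
  moreover have "continuous_on ?S (\<lambda>v. v \<bullet> (H *v v))"
    by (intro continuous_intros continuous_on_matrix_vector_mul)
  ultimately obtain v where v: "v \<in> ?S" and min: "\<And>u. u \<in> ?S \<Longrightarrow> v \<bullet> (H *v v) \<le> u \<bullet> (H *v u)"
    using continuous_attains_inf[OF compact_sphere, of 0 1 "\<lambda>v. v \<bullet> (H *v v)"] by blast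
  define r where "r = v \<bullet> (H *v v)"
  have le: "r * (norm u)\<^sup>2 \<le> u \<bullet> (H *v u)" for u
  proof (cases "u = 0")
    case False
    define w where "w = (1 / norm u) *\<^sub>R u"
    have u: "u = norm u *\<^sub>R w" using False by (simp add: w_def)
    have "r \<le> w \<bullet> (H *v w)"
      unfolding r_def using False by (intro min) (simp add: w_def)
    then have "(norm u)\<^sup>2 * r \<le> (norm u)\<^sup>2 * (w \<bullet> (H *v w))"
      by (intro mult_left_mono) auto
    also have "\<dots> = (norm u *\<^sub>R w) \<bullet> (H *v (norm u *\<^sub>R w))"
      by (simp add: matrix_vector_mul_scaleR power2_eq_square)
    finally show ?thesis using u by (simp add: mult.commute)
  qed simp
  let ?K = "H - mat (complex_of_real r)"
  have K: "?K *v u = H *v u - r *\<^sub>R u" for u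
    by (simp add: matrix_vector_mult_diff_rdistrib mat_complex_vector_mul)
  have "hermitian ?K"
    using H by (simp add: hermitian_def ctranspose_diff) (simp add: vec_eq_iff ctranspose_def mat_def)
  moreover have "0 \<le> u \<bullet> (?K *v u)" for u
    using le[of u] by (simp add: K inner_diff_right power2_norm_eq_inner)
  moreover have "v \<bullet> (?K *v v) = 0"
    using v by (simp add: K inner_diff_right r_def[symmetric] power2_norm_eq_inner[symmetric])
  ultimately have "?K *v v = 0" by (rule psd_kernel)
  then show thesis
    using that[of v r] v le by (force simp: K)
qed

text \<open>The \<open>LEAST\<close> in \<open>lambda_min\<close> means something only once a least
  element is exhibited. The minimum \<open>r\<close> of the form is an eigenvalue, and testing its
  bound on an eigenvector for \<open>s\<close> gives \<open>r \<le> s\<close>.\<close>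

lemma lambda_min_le:
  fixes H :: "complex^'n^'n"
  assumes "hermitian H"
  shows "lambda_min H * (norm u)\<^sup>2 \<le> u \<bullet> (H *v u)"
proof -
  obtain r v where r: "v \<noteq> 0" "H *v v = r *\<^sub>R v" and le: "\<And>u. r * (norm u)\<^sup>2 \<le> u \<bullet> (H *v u)"
    using hermitian_min_eigenvalue[OF assms] by metis
  have "lambda_min H = r"
    unfolding lambda_min_def
  proof (rule Least_equality)
    show "eigenvalue H (complex_of_real r)"
      using r by (auto simp: eigenvalue_def of_real_smult)
    fix s assume "eigenvalue H (complex_of_real s)"
    then obtain w where w: "w \<noteq> 0" "H *v w = s *\<^sub>R w"
      by (auto simp: eigenvalue_def of_real_smult)
    then show "r \<le> s"
      using le[of w] by (simp add: power2_norm_eq_inner)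
  qed
  with le show ?thesis by simp
qed

section \<open>The positive semidefinite square root\<close>

text \<open>The smallest eigenvalues of \<open>H\<close> and \<open>- H\<close> are both 0, so the
  form of \<open>H\<close> is at once nonnegative and nonpositive. It vanishes everywhere, and
  \<open>psd_kernel\<close> gives \<open>H v = 0\<close> for every \<open>v\<close>.\<close>

lemma hermitian_eq_0:
  fixes H :: "complex^'n^'n"
  assumes H: "hermitian H" and ev: "\<And>c v. v \<noteq> 0 \<Longrightarrow> H *v v = c *\<^sub>R v \<Longrightarrow> c = 0"
  shows "H = 0"
proof -
  have nonneg: "0 \<le> u \<bullet> (K *v u)"
    if K: "hermitian K" and "\<And>c v. v \<noteq> 0 \<Longrightarrow> K *v v = c *\<^sub>R v \<Longrightarrow> c = 0" for K :: "complex^'n^'n" and u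
  proof -
    obtain r v where "v \<noteq> 0" "K *v v = r *\<^sub>R v" and le: "\<And>u. r * (norm u)\<^sup>2 \<le> u \<bullet> (K *v u)"
      using hermitian_min_eigenvalue[OF K] by metis
    then have "r = 0" using that by blast
    with le[of u] show ?thesis by simp
  qed
  have neg: "(- H) *v v = - (H *v v)" for v
    using matrix_vector_mult_diff_rdistrib[of 0 H v] by simp
  have "0 \<le> u \<bullet> (H *v u)" for u
    using H ev by (rule nonneg)
  moreover have "0 \<le> u \<bullet> ((- H) *v u)" for u
  proof (rule nonneg)
    show "hermitian (- H)" using H by (simp add: hermitian_def ctranspose_minus)
    fix c v assume "v \<noteq> 0" "(- H) *v v = c *\<^sub>R v"
    then have "H *v v = (- c) *\<^sub>R v"
      by (simp add: neg) (metis minus_minus)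
    with \<open>v \<noteq> 0\<close> show "c = 0" using ev[of v "- c"] by simp
  qed
  ultimately have "v \<bullet> (H *v v) = 0" for v
    by (simp add: neg order_antisym)
  then have "H *v v = 0" for v
    using psd_kernel[OF H] by simp
  then show ?thesis
    by (simp add: matrix_eq)
qed

text \<open>Every real eigenvalue \<open>c\<close> of \<open>S - T\<close> is 0: equal squares give
  \<open>|S v| = |T v|\<close>, so \<open>S v - T v = c v\<close> is orthogonal to
  \<open>S v + T v\<close>.\<close>

lemma psd_sqrt_unique:
  fixes S T :: "complex^'n^'n"
  assumes S: "pos_semidef S" and T: "pos_semidef T" and eq: "S ** S = T ** T"
  shows "S = T"
proof -
  have hS: "hermitian S" and hT: "hermitian T"
    and pS: "\<And>v. 0 \<le> v \<bullet> (S *v v)" and pT: "\<And>v. 0 \<le> v \<bullet> (T *v v)"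
    using S T by (auto simp: pos_semidef_def Re_qform)
  have "S - T = 0"
  proof (rule hermitian_eq_0)
    show "hermitian (S - T)"
      using hS hT by (simp add: hermitian_def ctranspose_diff)
    fix c v assume "v \<noteq> 0" and ev: "(S - T) *v v = c *\<^sub>R v"
    then have d: "S *v v = T *v v + c *\<^sub>R v"
      by (simp add: matrix_vector_mult_diff_rdistrib algebra_simps)
    have "(S *v v) \<bullet> (S *v v) = (T *v v) \<bullet> (T *v v)"
      using hermitian_inner[OF hS, of v "S *v v"] hermitian_inner[OF hT, of v "T *v v"] eq
      by (simp add: matrix_vector_mul_assoc)
    then have "(S *v v - T *v v) \<bullet> (S *v v + T *v v) = 0"
      by (simp add: algebra_simps inner_commute)
    moreover have "S *v v - T *v v = c *\<^sub>R v" by (simp add: d)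
    ultimately have "(c *\<^sub>R v) \<bullet> (S *v v + T *v v) = 0" by simp
    then have "c * (v \<bullet> (S *v v) + v \<bullet> (T *v v)) = 0"
      by (simp only: inner_scaleR_left inner_add_right distrib_left)
    then have "c = 0 \<or> v \<bullet> (S *v v) + v \<bullet> (T *v v) = 0" by simp
    \<comment> \<open>Two nonnegative numbers with sum 0 both vanish. Their equality suffices, since
      the two forms differ by \<open>c |v|^2\<close>.\<close>
    then have "c = 0 \<or> v \<bullet> (S *v v) = v \<bullet> (T *v v)"
      using pS[of v] pT[of v] by linarith
    then show "c = 0"
      using \<open>v \<noteq> 0\<close> by (auto simp: d inner_add_right)
  qed
  then show ?thesis by simp
qed

text \<open>
  The equation \<open>(I - F)\<^sup>2 = I - E\<close> says \<open>F = (E + F\<^sup>2) / 2\<close>, a fixed point problem on the compact convex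
  set of Hermitian contractions, to which Brouwer's theorem applies.
\<close>

lemma hermitian_contraction_sqrt:
  fixes E :: "complex^'n^'n"
  assumes E: "hermitian E" "\<And>v. norm (E *v v) \<le> norm v"
  obtains F :: "complex^'n^'n" where "hermitian F" "\<And>v. norm (F *v v) \<le> norm v"
    "(mat 1 - F) ** (mat 1 - F) = mat 1 - E"
proof -
  define K where "K = {F :: complex^'n^'n. hermitian F \<and> (\<forall>v. norm (F *v v) \<le> norm v)}"
  define f where "f F = (1/2) *\<^sub>R (E + F ** F)" for F
  have K_eq: "K = {F. F\<^sup>H = F} \<inter> (\<Inter>v. {F. norm (F *v v) \<le> norm v})"
    by (auto simp: K_def hermitian_def)
  have "closed K"
    unfolding K_eq
    by (intro closed_Int closed_INT ballI closed_Collect_eq closed_Collect_le continuous_intros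
        continuous_on_ctranspose continuous_on_matrix_vector_mul)
  moreover have "bounded K"
  proof -
    have "norm F \<le> (\<Sum>i\<in>(UNIV::'n set). \<Sum>j\<in>(UNIV::'n set). 1)" if "F \<in> K" for F
    proof -
      \<comment> \<open>Each entry is a coordinate of the image of a unit vector under a
        contraction; this bounds \<open>K\<close>.\<close>
      have c: "norm (F $ i $ j) \<le> 1" for i j
      proof -
        have "norm (F $ i $ j) = norm ((F *v axis j 1) $ i)"
          by (simp add: matrix_vector_mult_def axis_def if_distrib[of "\<lambda>x. _ * x"] cong: if_cong)
        also have "\<dots> \<le> norm (F *v axis j 1)" by (rule Finite_Cartesian_Product.norm_nth_le)
        also have "\<dots> \<le> norm (axis j (1::complex) :: complex^'n)" using that unfolding K_def mem_Collect_eq by (elim conjE spec)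
        also have "\<dots> = 1" by (simp add: norm_eq_sqrt_inner inner_axis_axis)
        finally show ?thesis .
      qed
      have "norm F \<le> (\<Sum>i\<in>UNIV. norm (F $ i))"
        unfolding norm_vec_def by (intro L2_set_le_sum) auto
      also have "\<dots> \<le> (\<Sum>i\<in>UNIV. \<Sum>j\<in>UNIV. norm (F $ i $ j))"
        unfolding norm_vec_def by (intro sum_mono L2_set_le_sum) auto
      also have "\<dots> \<le> (\<Sum>i\<in>(UNIV::'n set). \<Sum>j\<in>(UNIV::'n set). 1)"
        by (intro sum_mono c)
      finally show ?thesis .
    qed
    then show ?thesis unfolding bounded_iff by blast
  qed
  ultimately have "compact K" by (simp add: compact_eq_bounded_closed)
  moreover have "convex K"
  proof (rule convexI)
    fix F G and a b :: real
    assume FG: "F \<in> K" "G \<in> K" and ab: "0 \<le> a" "0 \<le> b" "a + b = 1"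
    have "norm ((a *\<^sub>R F + b *\<^sub>R G) *v v) \<le> norm v" for v
    proof -
      have "norm ((a *\<^sub>R F + b *\<^sub>R G) *v v) \<le> a * norm (F *v v) + b * norm (G *v v)"
        using ab norm_triangle_ineq[of "a *\<^sub>R (F *v v)" "b *\<^sub>R (G *v v)"]
        by (simp add: matrix_vector_mult_add_rdistrib matrix_vector_mul_scaleR)
      also have "\<dots> \<le> a * norm v + b * norm v"
        using FG ab by (intro add_mono mult_left_mono) (auto simp: K_def)
      finally show ?thesis using ab by (simp add: distrib_right[symmetric])
    qed
    then show "a *\<^sub>R F + b *\<^sub>R G \<in> K"
      using FG by (simp add: K_def hermitian_def ctranspose_add ctranspose_scaleR)
  qed
  moreover have "K \<noteq> {}"
    using E by (auto simp: K_def)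
  moreover have "continuous_on K f"
    unfolding f_def by (intro continuous_intros continuous_on_matrix_mul)
  \<comment> \<open>\<open>F ** F\<close> is again a Hermitian contraction, and \<open>f F\<close>
    is its average with \<open>E\<close>.\<close>
  moreover have "f \<in> K \<rightarrow> K"
  proof
    fix F assume F: "F \<in> K"
    have "norm (f F *v v) \<le> norm v" for v
    proof -
      have "norm (F *v (F *v v)) \<le> norm v"
        using F order_trans unfolding K_def by blast
      then have "norm (E *v v + F *v (F *v v)) \<le> norm v + norm v"
        using E(2) by (intro norm_triangle_mono)
      then show ?thesis
        by (simp add: f_def matrix_vector_mul_scaleR matrix_vector_mult_add_rdistrib matrix_vector_mul_assoc)
    qed
    then show "f F \<in> K"
      using F E(1) by (simp add: K_def f_def hermitian_def ctranspose_add ctranspose_scaleR ctranspose_mul)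
  qed
  ultimately obtain F where F: "F \<in> K" "f F = F"
    by (rule brouwer)
  have "2 *\<^sub>R F = 2 *\<^sub>R f F" by (simp add: F)
  then have "F + F = E + F ** F" by (simp add: f_def scaleR_2)
  then have "(mat 1 - F) ** (mat 1 - F) = mat 1 - E"
    by (simp add: matrix_diff_ldistrib matrix_diff_rdistrib algebra_simps)
  with F that show thesis by (auto simp: K_def)
qed

text \<open>Scaling by a small \<open>c\<close> makes \<open>E = I - c Z\<^sup>H Z\<close> a
  contraction. The root \<open>I - F\<close> of \<open>I - E\<close> is positive semidefinite
  because \<open>F\<close> is a contraction, and rescaling it gives \<open>S\<close>.\<close>

lemma psd_sqrt_exists:
  fixes Z :: "complex^'q^'p"
  obtains S where "pos_semidef S" "S ** S = Z\<^sup>H ** Z"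
proof -
  \<comment> \<open>\<open>k\<close> dominates the squared norm of \<open>Z\<^sup>H\<close>; the
    \<open>+ 1\<close> keeps it positive when \<open>Z = 0\<close>.\<close>
  define k where "k = spectral_norm (Z\<^sup>H) ^ 2 + 1"
  define c where "c = 1 / k"
  have "k > 0" unfolding k_def by (simp add: add_nonneg_pos)
  then have c: "c > 0" by (simp add: c_def)
  define E where "E = mat 1 - c *\<^sub>R (Z\<^sup>H ** Z)"
  have Ev: "E *v v = v - c *\<^sub>R (Z\<^sup>H *v (Z *v v))" for v
    by (simp add: E_def matrix_vector_mult_diff_rdistrib matrix_vector_mul_scaleR matrix_vector_mul_assoc)
  have "hermitian E"
    by (simp add: E_def hermitian_def ctranspose_diff ctranspose_scaleR ctranspose_mul ctranspose_ctranspose ctranspose_mat_1)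
  moreover have "norm (E *v v) \<le> norm v" for v
  proof -
    let ?w = "Z *v v"
    have "(norm (Z\<^sup>H *v ?w))\<^sup>2 \<le> (spectral_norm (Z\<^sup>H) * norm ?w)\<^sup>2"
      by (intro power_mono norm_matrix_vector_mul_le) simp
    also have "\<dots> \<le> k * (norm ?w)\<^sup>2"
      by (simp add: k_def power_mult_distrib distrib_right)
    finally have "c * (norm (Z\<^sup>H *v ?w))\<^sup>2 \<le> c * (k * (norm ?w)\<^sup>2)"
      using c by simp
    then have "c * (norm (Z\<^sup>H *v ?w))\<^sup>2 \<le> (norm ?w)\<^sup>2"
      using \<open>k > 0\<close> by (simp add: c_def)
    then have b: "c * (c * (norm (Z\<^sup>H *v ?w))\<^sup>2) \<le> c * (norm ?w)\<^sup>2"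
      using c by (intro mult_left_mono) auto
    have ip: "v \<bullet> (Z\<^sup>H *v ?w) = (norm ?w)\<^sup>2"
      using inner_ctranspose[of Z ?w v] by (simp add: inner_commute power2_norm_eq_inner)
    \<comment> \<open>By \<open>b\<close> the last term is at most \<open>c |Z v|^2\<close>, half of
      what the middle term subtracts.\<close>
    have "(norm (E *v v))\<^sup>2 = (norm v)\<^sup>2 - 2 * c * (norm ?w)\<^sup>2 + c * (c * (norm (Z\<^sup>H *v ?w))\<^sup>2)"
      using ip unfolding Ev power2_norm_eq_inner
      by (simp add: inner_diff inner_commute)
    also have "\<dots> \<le> (norm v)\<^sup>2"
    proof -
      have "0 \<le> c * (norm ?w)\<^sup>2" using c by simp
      with b show ?thesis by linarith
    qed
    finally show ?thesis by (rule power2_le_imp_le) simp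
  qed
  ultimately obtain F where F: "hermitian F" "\<And>v. norm (F *v v) \<le> norm v"
    and sq: "(mat 1 - F) ** (mat 1 - F) = mat 1 - E"
    using hermitian_contraction_sqrt by blast
  \<comment> \<open>Chosen so that \<open>s^2 c = 1\<close>, which undoes the scaling after
    squaring.\<close>
  define s where "s = 1 / sqrt c"
  have s: "s > 0" "s * s * c = 1" using c by (auto simp: s_def)
  define S where "S = s *\<^sub>R (mat 1 - F)"
  show thesis
  proof
    have "0 \<le> v \<bullet> ((mat 1 - F) *v v)" for v
    proof -
      have "v \<bullet> (F *v v) \<le> norm v * norm (F *v v)" by (rule norm_cauchy_schwarz)
      also have "\<dots> \<le> norm v * norm v" using F(2) by (simp add: mult_left_mono)
      finally show ?thesis
        by (simp add: matrix_vector_mult_diff_rdistrib inner_diff_right power2_norm_eq_inner[symmetric] power2_eq_square)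
    qed
    then show "pos_semidef S"
      using F(1) s by (simp add: pos_semidef_def Re_qform S_def matrix_vector_mul_scaleR hermitian_def
          ctranspose_scaleR ctranspose_diff ctranspose_mat_1)
    have "S ** S = (s * s) *\<^sub>R ((mat 1 - F) ** (mat 1 - F))"
      unfolding S_def by (simp add: vec_eq_iff matrix_matrix_mult_def scaleR_sum_right)
    also have "\<dots> = Z\<^sup>H ** Z"
      unfolding sq using s(2) by (simp add: E_def)
    finally show "S ** S = Z\<^sup>H ** Z" .
  qed
qed

text \<open>Existence and uniqueness together make the \<open>THE\<close> in
  \<open>matrix_sqrt\<close> denote an actual root.\<close>

lemma matrix_sqrt_gram:
  fixes Z :: "complex^'q^'p"
  shows "pos_semidef (matrix_sqrt (Z\<^sup>H ** Z))"
    and "matrix_sqrt (Z\<^sup>H ** Z) ** matrix_sqrt (Z\<^sup>H ** Z) = Z\<^sup>H ** Z"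
proof -
  obtain S where S: "pos_semidef S" "S ** S = Z\<^sup>H ** Z"
    by (rule psd_sqrt_exists)
  then have "matrix_sqrt (Z\<^sup>H ** Z) = S"
    unfolding matrix_sqrt_def by (intro the_equality) (auto intro: psd_sqrt_unique)
  with S show "pos_semidef (matrix_sqrt (Z\<^sup>H ** Z))"
    "matrix_sqrt (Z\<^sup>H ** Z) ** matrix_sqrt (Z\<^sup>H ** Z) = Z\<^sup>H ** Z" by auto
qed

section \<open>The passivity radius\<close>

text \<open>The matrix \<open>Z\<close> of the overview: \<open>[-X 0]\<close> stacked on an
  identity matrix, with the identity split into its two block rows.\<close>

definition pert_frame :: "complex^'n^'n \<Rightarrow> complex^('n::finite + 'm::finite)^('n + ('n + 'm))"
  where "pert_frame X = vcat (hcat (- X) 0) (vcat (hcat (mat 1) 0) (hcat 0 (mat 1)))"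

lemmas block_simps = vcat_mul mul_hcat hcat_mul_vcat hcat_add vcat_add hcat_diff vcat_diff
  hcat_vcat hcat_0 vcat_0
  ctranspose_hcat ctranspose_vcat ctranspose_0 ctranspose_mat_1 ctranspose_minus

lemma pert_frame_gram:
  assumes "hermitian X"
  shows "(pert_frame X)\<^sup>H ** pert_frame X
    = vcat (hcat (mat 1 + X ** X) 0) (hcat 0 (mat 1 :: complex^'m^'m))"
  using assms
  by (simp add: pert_frame_def block_simps matrix_mul_minus hermitian_def add.commute)

text \<open>The matrix \<open>N\<close> of the overview, named so that its norm and its compression
  by \<open>Z\<close> can be discussed separately.\<close>

fun pert_matrix :: "('n::finite, 'm::finite) system \<Rightarrow> complex^('n + ('n + 'm))^('n + ('n + 'm))"
  where "pert_matrix (\<Delta>A, \<Delta>B, \<Delta>C, \<Delta>D) =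
    vcat (hcat (0 :: complex^'n^'n) (hcat \<Delta>A \<Delta>B))
    (vcat (hcat (\<Delta>A\<^sup>H)             (hcat 0 (\<Delta>C\<^sup>H)))
          (hcat (\<Delta>B\<^sup>H)             (hcat \<Delta>C (\<Delta>D + \<Delta>D\<^sup>H))))"

lemma pert_norm_eq: "pert_norm \<Delta> = spectral_norm (pert_matrix \<Delta>)"
  by (cases \<Delta>) simp

text \<open>The zero corner block of \<open>N\<close> excludes terms quadratic in \<open>X\<close>;
  the off-diagonal blocks produce the terms linear in \<open>X\<close>.\<close>

lemma W_c_factor:
  assumes "hermitian X"
  shows "W_c X \<Delta> = (pert_frame X)\<^sup>H ** (pert_matrix \<Delta> ** pert_frame X)"
proof (cases \<Delta>)
  case (fields a b c d)
  have comm: "- (a\<^sup>H ** X) - X ** a = - (X ** a) - a\<^sup>H ** X" by simp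
  from assms show ?thesis
    by (simp add: fields pert_frame_def block_simps matrix_mul_minus hermitian_def) (simp only: comm)
qed

lemma W_c_add: "W_c X (M + \<Delta>) = W_c X M + W_c X \<Delta>"
  by (cases M; cases \<Delta>) (simp add: block_simps ctranspose_add matrix_add_ldistrib matrix_add_rdistrib algebra_simps)

lemma W_c_0: "W_c X 0 = 0"
  using W_c_add[of X 0 0] by simp

lemma mat_1_block:
  "(mat 1 :: complex^('n::finite + 'm::finite)^('n + 'm)) = vcat (hcat (mat 1) 0) (hcat 0 (mat 1))"
  by (simp add: vec_eq_iff vcat_def hcat_def mat_def split: sum.split)

lemma gram_inner: "v \<bullet> ((Z\<^sup>H ** Z) *v v) = (norm (Z *v v))\<^sup>2"
  using inner_ctranspose[of Z "Z *v v" v]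
  by (simp add: matrix_vector_mul_assoc inner_commute power2_norm_eq_inner)

text \<open>With \<open>Q = [X 0]\<close>, the Gram matrix of \<open>Z\<close> is
  \<open>I + Q\<^sup>H Q\<close>, hence \<open>|Z v|^2 = |v|^2 + |Q v|^2\<close>.\<close>

lemma norm_le_pert_frame:
  fixes X :: "complex^'n^'n" and v :: "complex^('n + 'm::finite)"
  assumes X: "hermitian X"
  shows "norm v \<le> norm (pert_frame X *v v)"
proof -
  let ?Z = "pert_frame X :: complex^('n + 'm)^('n + ('n + 'm))"
  define Q where "Q = (hcat X 0 :: complex^('n + 'm)^'n)"
  have "Q\<^sup>H ** Q = vcat (hcat (X ** X) 0) (hcat 0 0)"
    using X by (simp add: Q_def ctranspose_hcat ctranspose_0 vcat_mul hermitian_def)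
      (simp add: mul_hcat hcat_0)
  then have "?Z\<^sup>H ** ?Z = mat 1 + Q\<^sup>H ** Q"
    unfolding pert_frame_gram[OF X] mat_1_block by (simp add: hcat_add vcat_add)
  then have "(norm (?Z *v v))\<^sup>2 = (norm v)\<^sup>2 + (norm (Q *v v))\<^sup>2"
    unfolding gram_inner[symmetric]
    by (simp add: matrix_vector_mult_add_rdistrib inner_add_right power2_norm_eq_inner)
  then have "(norm v)\<^sup>2 \<le> (norm (?Z *v v))\<^sup>2" by simp
  then show ?thesis by (rule power2_le_imp_le) simp
qed

section \<open>The weight \<open>Y_c\<close> and its inverse\<close>

text \<open>\<open>S\<close> is the square root of \<open>Z\<^sup>H Z\<close>. Equal Gram matrices
  give \<open>|S v| = |Z v|\<close>, which is at least \<open>|v|\<close>, so \<open>S\<close> has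
  trivial kernel and \<open>matrix_inv\<close> yields a true inverse.\<close>

lemma Y_c_properties:
  fixes X :: "complex^'n^'n"
  assumes X: "hermitian X"
  defines "Y \<equiv> Y_c X :: complex^('n + 'm::finite)^('n + 'm)"
  obtains S where "S ** Y = mat 1" "Y ** S = mat 1" "hermitian S" "hermitian Y"
    "\<And>v. norm (S *v v) = norm (pert_frame X *v v)"
proof -
  let ?Z = "pert_frame X :: complex^('n + 'm)^('n + ('n + 'm))"
  define S where "S = matrix_sqrt (?Z\<^sup>H ** ?Z)"
  have Y: "Y = matrix_inv S"
    by (simp add: Y_def Y_c_def S_def pert_frame_gram[OF X])
  have S: "hermitian S"
    using matrix_sqrt_gram(1)[of ?Z] by (simp add: S_def pos_semidef_def)
  have "S\<^sup>H ** S = ?Z\<^sup>H ** ?Z"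
    using matrix_sqrt_gram(2)[of ?Z] S by (simp add: S_def hermitian_def)
  then have n: "norm (S *v v) = norm (?Z *v v)" for v
    using gram_inner[of v S] gram_inner[of v ?Z] by simp
  have "invertible S"
    unfolding invertible_left_inverse matrix_left_invertible_ker
    using n norm_le_pert_frame[OF X] by (metis norm_le_zero_iff norm_zero)
  then have inv: "S ** Y = mat 1" "Y ** S = mat 1"
    unfolding Y using someI_ex[OF \<open>invertible S\<close>[unfolded invertible_def]] by (simp_all add: matrix_inv_def)
  \<comment> \<open>\<open>Y\<^sup>H\<close> is then another left inverse of \<open>S\<close>, so it
    coincides with \<open>Y\<close>.\<close>
  have "Y\<^sup>H ** S = mat 1"
    using arg_cong[OF inv(1), of ctranspose] S by (simp add: ctranspose_mul ctranspose_mat_1 hermitian_def)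
  then have "Y\<^sup>H = Y"
    using inv by (metis matrix_mul_assoc matrix_mul_lid matrix_mul_rid)
  then show thesis
    using that inv S n by (simp add: hermitian_def)
qed

text \<open>\<open>Y\<close> is a contraction because \<open>|Y v| \<le> |S (Y v)| = |v|\<close>;
  Cauchy-Schwarz then bounds its form by \<open>|v|^2\<close>.\<close>

lemma Y_c_le_mat_1:
  fixes X :: "complex^'n^'n"
  assumes X: "hermitian X"
  shows "(Y_c X :: complex^('n + 'm::finite)^('n + 'm)) \<preceq> mat 1"
proof -
  let ?Y = "Y_c X :: complex^('n + 'm)^('n + 'm)"
  obtain S where S: "S ** ?Y = mat 1" "hermitian ?Y"
    "\<And>v. norm (S *v v) = norm (pert_frame X *v v)"
    using Y_c_properties[OF X] by metis
  have "0 \<le> v \<bullet> ((mat 1 - ?Y) *v v)" for v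
  proof -
    have "norm (?Y *v v) \<le> norm (S *v (?Y *v v))"
      unfolding S(3) by (rule norm_le_pert_frame[OF X])
    also have "\<dots> = norm v" by (simp add: matrix_vector_mul_assoc S(1))
    finally have "v \<bullet> (?Y *v v) \<le> norm v * norm v"
      using norm_cauchy_schwarz[of v "?Y *v v"] by (meson mult_left_mono norm_ge_zero order_trans)
    then show ?thesis
      by (simp add: matrix_vector_mult_diff_rdistrib inner_diff_right power2_norm_eq_inner[symmetric] power2_eq_square)
  qed
  then show ?thesis
    using S(2) by (simp add: loewner_le_def pos_semidef_def Re_qform hermitian_def ctranspose_diff ctranspose_mat_1)
qed

section \<open>The lower bound on the radius\<close>

text \<open>The bound for a single admissible perturbation: at a kernel vector \<open>v\<close> of
  the perturbed matrix, the form of \<open>W_c X M\<close> is estimated from both sides by multiples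
  of \<open>|Z v|^2\<close>.\<close>

lemma lambda_min_le_pert_norm:
  fixes X :: "complex^'n^'n" and M \<Delta> :: "('n, 'm::finite) system"
  assumes X: "hermitian X" and W: "hermitian (W_c X M)" and det: "det (W_c X (M + \<Delta>)) = 0"
  shows "lambda_min (Y_c X ** W_c X M ** Y_c X) \<le> pert_norm \<Delta>"
proof -
  let ?W = "W_c X M" and ?N = "pert_matrix \<Delta>"
  let ?Z = "pert_frame X :: complex^('n + 'm)^('n + ('n + 'm))"
  let ?Y = "Y_c X :: complex^('n + 'm)^('n + 'm)"
  obtain S where S: "?Y ** S = mat 1" "hermitian ?Y" "\<And>v. norm (S *v v) = norm (?Z *v v)"
    using Y_c_properties[OF X] by metis
  obtain v where v: "v \<noteq> 0" "W_c X (M + \<Delta>) *v v = 0"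
    using det invertible_det_nz[of "W_c X (M + \<Delta>)"]
    unfolding invertible_left_inverse matrix_left_invertible_ker by auto
  define z where "z = ?Z *v v"
  have "norm z > 0"
    using v(1) norm_le_pert_frame[OF X, of v] by (simp add: z_def) (metis norm_le_zero_iff norm_zero)
  \<comment> \<open>\<open>W_c\<close> is additive in the system, so on the kernel vector the two
    contributions cancel.\<close>
  have "?W *v v = - (W_c X \<Delta> *v v)"
    using v(2) by (simp add: W_c_add matrix_vector_mult_add_rdistrib add_eq_0_iff)
  then have "v \<bullet> (?W *v v) = - (v \<bullet> (?Z\<^sup>H *v (?N *v z)))"
    by (simp add: W_c_factor[OF X] z_def matrix_vector_mul_assoc)
  also have "\<dots> = - (z \<bullet> (?N *v z))"
    using inner_ctranspose[of ?Z "?N *v z" v] by (simp add: z_def inner_commute)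
  also have "\<dots> \<le> norm z * norm (?N *v z)"
    using Cauchy_Schwarz_ineq2[of z "?N *v z"] by simp
  also have "\<dots> \<le> norm z * (pert_norm \<Delta> * norm z)"
    unfolding pert_norm_eq by (intro mult_left_mono norm_matrix_vector_mul_le) simp
  finally have upper: "v \<bullet> (?W *v v) \<le> pert_norm \<Delta> * (norm z)\<^sup>2"
    by (simp add: power2_eq_square algebra_simps)
  let ?G = "?Y ** ?W ** ?Y"
  \<comment> \<open>\<open>S v\<close> is the test vector for \<open>Y W Y\<close>: since
    \<open>Y\<close> undoes \<open>S\<close>, the form there equals that of \<open>W\<close> at
    \<open>v\<close>.\<close>
  have Yv: "?Y *v (S *v v) = v" by (simp add: matrix_vector_mul_assoc S(1))
  have "hermitian ?G"
    using S(2) W by (simp add: hermitian_def ctranspose_mul matrix_mul_assoc)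
  then have "lambda_min ?G * (norm (S *v v))\<^sup>2 \<le> (S *v v) \<bullet> (?G *v (S *v v))"
    by (rule lambda_min_le)
  also have "?G *v (S *v v) = ?Y *v (?W *v v)"
    by (simp only: matrix_vector_mul_assoc[symmetric] Yv)
  also have "(S *v v) \<bullet> \<dots> = v \<bullet> (?W *v v)"
    using hermitian_inner[OF S(2), of "S *v v" "?W *v v"] by (simp only: Yv)
  finally have "lambda_min ?G * (norm z)\<^sup>2 \<le> v \<bullet> (?W *v v)"
    by (simp add: S(3) z_def)
  with upper have "lambda_min ?G * (norm z)\<^sup>2 \<le> pert_norm \<Delta> * (norm z)\<^sup>2" by linarith
  with \<open>norm z > 0\<close> show ?thesis by simp
qed

theorem lemma5p1:
  fixes A :: "complex^'n^'n" and B :: "complex^'m^'n"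
    and C :: "complex^'n^'m" and D :: "complex^'m^'m"
    and X :: "complex^'n^'n"
  assumes "minimal (A, B, C, D)"
    and "rank B = CARD('m)" and "rank C = CARD('m)"
    and "hermitian X" and "pos_def X"
    and "pos_def (W_c X (A, B, C, D))"
  shows "lambda_min (Y_c X ** W_c X (A, B, C, D) ** Y_c X) \<le> X_passivity_radius X (A, B, C, D)
    \<and> (Y_c X :: complex^('n + 'm)^('n + 'm)) \<preceq> mat 1"
proof
  let ?M = "(A, B, C, D)"
  have W: "hermitian (W_c X ?M)" using assms(6) by (simp only: pos_def_def)
  \<comment> \<open>The perturbation cancelling the whole system makes the set nonempty, as a
    greatest-lower-bound argument over the reals requires.\<close>
  have "?M + (- A, - B, - C, - D) = 0" by (simp add: zero_prod_def)
  then have "W_c X (?M + (- A, - B, - C, - D)) = 0" by (simp only: W_c_0)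
  then have "det (W_c X (?M + (- A, - B, - C, - D))) = 0" by (metis det_0 mat_0)
  then have "{pert_norm \<Delta> | \<Delta>. det (W_c X (?M + \<Delta>)) = 0} \<noteq> {}" by blast
  then show "lambda_min (Y_c X ** W_c X ?M ** Y_c X) \<le> X_passivity_radius X ?M"
    unfolding X_passivity_radius_def
    by (rule cInf_greatest) (use lambda_min_le_pert_norm[OF assms(4) W] in blast)
  show "(Y_c X :: complex^('n + 'm)^('n + 'm)) \<preceq> mat 1"
    by (rule Y_c_le_mat_1[OF assms(4)])
qed

end
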